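(* Let $(\mathcal S,U,P)$ be a BCL triple with associated BCL pair $(M_{\phi_1},M_{\phi_2})$ on $H^2_{\mathcal S}(\mathbb T)$. Then $H(M_{\phi_1},M_{\phi_2})$ is a compact operator if and only if both $PUP$ and $U^2P-PU^2$ are compact.
   Context: A BCL triple $(\mathcal S,U,P)$ consists of a complex separable Hilbert space $\mathcal S$, a unitary $U$ on $\mathcal S$ and an orthogonal projection $P$ on $\mathcal S$; $P^\perp=I-P$. $H^2(\mathbb T)$ is the Hardy space of the circle, $S_z$ is multiplication by $z$ on it, and $H^2_{\mathcal S}(\mathbb T)$ ($\mathcal S$-valued Hardy space) is identified with $H^2(\mathbb T)\otimes\mathcal S$. The BCL pair is the commuting pair of isometries $M_{\phi_1}=I\otimes PU^*+S_z\otimes P^\perp U^*$, $M_{\phi_2}=I\otimes UP^\perp+S_z\otimes UP$. For commuting isometries $(V_1,V_2)$, $H(V_1,V_2):=V_2V_2^*-V_1V_1^*-V_2^2V_2^{*2}+V_1V_2V_1^*V_2^*$. *)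

theory Defs
  imports "HOL-Analysis.Analysis"
begin

section \<open>Complex Hilbert spaces\<close>

text \<open>
  The complex inner product is linear in its first argument.  A complex inner product space is
  at the same time a real one, with inner product \<open>Re (cinner x y)\<close>; hence the norm
  inherited from \<^class>\<open>real_inner\<close> is the one induced by \<open>cinner\<close>.
\<close>

class complex_inner = real_inner +
  fixes scaleC :: "complex \<Rightarrow> 'a \<Rightarrow> 'a"  (infixr "*\<^sub>C" 75)
    and cinner :: "'a \<Rightarrow> 'a \<Rightarrow> complex"
  assumes scaleC_add_right: "a *\<^sub>C (x + y) = a *\<^sub>C x + a *\<^sub>C y"
    and scaleC_add_left: "(a + b) *\<^sub>C x = a *\<^sub>C x + b *\<^sub>C x"
    and scaleC_scaleC: "a *\<^sub>C b *\<^sub>C x = (a * b) *\<^sub>C x"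
    and scaleC_of_real: "complex_of_real r *\<^sub>C x = r *\<^sub>R x"
    and cinner_commute: "cinner x y = cnj (cinner y x)"
    and cinner_add_left: "cinner (x + y) z = cinner x z + cinner y z"
    and cinner_scaleC_left: "cinner (a *\<^sub>C x) y = a * cinner x y"
    and Re_cinner: "Re (cinner x y) = inner x y"

class complex_hilbert_space = complex_inner + complete_space

subclass (in complex_hilbert_space) banach ..

text \<open>For metric spaces, second countability and separability coincide.\<close>

class separable_complex_hilbert_space = complex_hilbert_space + second_countable_topology

lemma scaleC_one: "1 *\<^sub>C x = x"
  using scaleC_of_real [of 1 x] by simp

lemma scaleC_zero: "0 *\<^sub>C x = 0"
  using scaleC_of_real [of 0 x] by simp

lemma cinner_scaleC_right: "cinner x (a *\<^sub>C y) = cnj a * cinner x y"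
  by (metis cinner_commute cinner_scaleC_left complex_cnj_mult)

lemma cinner_add_right: "cinner x (y + z) = cinner x y + cinner x z"
  by (metis cinner_commute cinner_add_left complex_cnj_add)

lemma Im_cinner: "Im (cinner x y) = inner (- \<i> *\<^sub>C x) y"
  using Re_cinner [of "- \<i> *\<^sub>C x" y] by (simp add: cinner_scaleC_left)

lemma norm_scaleC: "norm (a *\<^sub>C x) = cmod a * norm x"
proof -
  have "inner (a *\<^sub>C x) (a *\<^sub>C x) = Re (a * cnj a * cinner x x)"
    by (simp only: Re_cinner [symmetric] cinner_scaleC_left cinner_scaleC_right mult.assoc mult.left_commute)
  also have "\<dots> = Re (complex_of_real ((cmod a)\<^sup>2) * cinner x x)"
    by (simp only: complex_norm_square)
  also have "\<dots> = (cmod a)\<^sup>2 * inner x x"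
    by (simp only: Re_complex_of_real Im_complex_of_real times_complex.sel Re_cinner)
  finally show ?thesis
    by (simp add: norm_eq_sqrt_inner real_sqrt_mult)
qed

lemma bounded_bilinear_scaleC: "bounded_bilinear ((*\<^sub>C) :: complex \<Rightarrow> 'a \<Rightarrow> 'a::complex_inner)"
proof
  fix a b :: complex and x y :: 'a and r :: real
  show "(a + b) *\<^sub>C x = a *\<^sub>C x + b *\<^sub>C x" by (rule scaleC_add_left)
  show "a *\<^sub>C (x + y) = a *\<^sub>C x + a *\<^sub>C y" by (rule scaleC_add_right)
  show "(r *\<^sub>R a) *\<^sub>C x = r *\<^sub>R a *\<^sub>C x"
    by (simp add: scaleC_of_real [symmetric] scaleC_scaleC scaleR_conv_of_real)
  show "a *\<^sub>C r *\<^sub>R x = r *\<^sub>R a *\<^sub>C x"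
    by (simp add: scaleC_of_real [symmetric] scaleC_scaleC mult.commute)
  show "\<exists>K. \<forall>a x. norm (a *\<^sub>C (x::'a)) \<le> norm a * norm x * K"
    by (rule exI [of _ 1]) (simp add: norm_scaleC)
qed

lemma cmod_cinner_le: "cmod (cinner x y) \<le> 2 * (norm x * norm y)"
proof -
  have "\<bar>Im (cinner x y)\<bar> \<le> norm (- \<i> *\<^sub>C x) * norm y"
    unfolding Im_cinner by (rule Cauchy_Schwarz_ineq2)
  moreover have "\<bar>Re (cinner x y)\<bar> \<le> norm x * norm y"
    unfolding Re_cinner by (rule Cauchy_Schwarz_ineq2)
  ultimately show ?thesis
    using cmod_le [of "cinner x y"] by (simp add: norm_scaleC)
qed

lemma bounded_bilinear_cinner: "bounded_bilinear (cinner :: 'a \<Rightarrow> 'a \<Rightarrow> complex)"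
  for dummy :: "'a::complex_inner itself"
proof
  fix x y z :: 'a and r :: real
  show "cinner (x + y) z = cinner x z + cinner y z" by (rule cinner_add_left)
  show "cinner x (y + z) = cinner x y + cinner x z" by (rule cinner_add_right)
  show "cinner (r *\<^sub>R x) y = r *\<^sub>R cinner x y"
    by (simp add: scaleC_of_real [symmetric] cinner_scaleC_left scaleR_conv_of_real)
  show "cinner x (r *\<^sub>R y) = r *\<^sub>R cinner x y"
    by (simp add: scaleC_of_real [symmetric] cinner_scaleC_right scaleR_conv_of_real)
  show "\<exists>K. \<forall>x y. norm (cinner (x::'a) y) \<le> norm x * norm y * K"
    by (rule exI [of _ 2]) (simp add: cmod_cinner_le mult.commute [of _ 2])
qed

instantiation complex :: separable_complex_hilbert_space
begin

definition scaleC_complex :: "complex \<Rightarrow> complex \<Rightarrow> complex" where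
  "scaleC_complex = (*)"

definition cinner_complex :: "complex \<Rightarrow> complex \<Rightarrow> complex" where
  "cinner_complex x y = x * cnj y"

instance
  by standard
    (simp_all add: scaleC_complex_def cinner_complex_def algebra_simps scaleR_conv_of_real
      inner_complex_def)

end

section \<open>Operators\<close>

definition bounded_clinear :: "('a::complex_inner \<Rightarrow> 'b::complex_inner) \<Rightarrow> bool" where
  "bounded_clinear T \<longleftrightarrow> bounded_linear T \<and> (\<forall>a x. T (a *\<^sub>C x) = a *\<^sub>C T x)"

text \<open>On a Hilbert space the adjoint of a bounded operator exists and is unique.\<close>

definition cadjoint :: "('a::complex_inner \<Rightarrow> 'b::complex_inner) \<Rightarrow> 'b \<Rightarrow> 'a" where
  "cadjoint T = (THE T'. \<forall>x y. cinner (T x) y = cinner x (T' y))"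

definition unitary_op :: "('a::complex_inner \<Rightarrow> 'a) \<Rightarrow> bool" where
  "unitary_op U \<longleftrightarrow> bounded_clinear U \<and> surj U \<and> (\<forall>x y. cinner (U x) (U y) = cinner x y)"

definition orthogonal_projection :: "('a::complex_inner \<Rightarrow> 'a) \<Rightarrow> bool" where
  "orthogonal_projection P \<longleftrightarrow>
     bounded_clinear P \<and> (\<forall>x. P (P x) = P x) \<and> (\<forall>x y. cinner (P x) y = cinner x (P y))"

definition compact_op :: "('a::complex_inner \<Rightarrow> 'b::complex_inner) \<Rightarrow> bool" where
  "compact_op T \<longleftrightarrow> bounded_clinear T \<and> compact (closure (T ` cball 0 1))"

section \<open>The vector-valued Hardy space of the circle\<close>

text \<open>Normalised arc length, as a Borel measure on the plane that is carried by the unit circle.\<close>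

definition circle_measure :: "complex measure" where
  "circle_measure = distr (uniform_measure lborel {0..2 * pi}) borel cis"

text \<open>
  The Fourier coefficient of index \<open>k\<close> of \<open>f\<close> is the integral of
  \<open>z powi (- k) *\<^sub>C f z\<close>; those of index \<open>- n\<close> with \<open>n \<ge> 1\<close> are
  required to vanish.  Elements of the Hardy space are classes of such square-integrable functions
  modulo equality almost everywhere.
\<close>

definition hardy_fun :: "(complex \<Rightarrow> 'a::separable_complex_hilbert_space) \<Rightarrow> bool" where
  "hardy_fun f \<longleftrightarrow>
     f \<in> borel_measurable circle_measure \<and>
     integrable circle_measure (\<lambda>z. (norm (f z))\<^sup>2) \<and>
     (\<forall>n\<ge>1. (\<integral>z. z ^ n *\<^sub>C f z \<partial>circle_measure) = 0)"

definition hardy_rel ::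
    "(complex \<Rightarrow> 'a::separable_complex_hilbert_space) \<Rightarrow> (complex \<Rightarrow> 'a) \<Rightarrow> bool" where
  "hardy_rel f g \<longleftrightarrow> hardy_fun f \<and> hardy_fun g \<and> (AE z in circle_measure. f z = g z)"

lemma space_circle_measure [simp]: "space circle_measure = UNIV"
  and sets_circle_measure [simp, measurable_cong]: "sets circle_measure = sets borel"
  by (simp_all add: circle_measure_def)

lemma cis_measurable_uniform [measurable]:
  "cis \<in> measurable (uniform_measure lborel {0..2 * pi}) borel"
proof -
  have "cis \<in> borel_measurable borel"
    by (intro borel_measurable_continuous_onI continuous_intros)
  then show ?thesis by (simp add: measurable_def)
qed

lemma prob_circle_measure: "emeasure circle_measure UNIV = 1"
proof -
  have "emeasure (uniform_measure lborel {0..2 * pi}) UNIV = 1"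
    by (subst emeasure_uniform_measure) (simp_all add: ennreal_divide_self)
  then show ?thesis
    unfolding circle_measure_def by (subst emeasure_distr) auto
qed

interpretation circle: finite_measure circle_measure
  by (rule finite_measureI) (simp add: prob_circle_measure)

lemma AE_circle_cmod: "AE z in circle_measure. cmod z = 1"
  unfolding circle_measure_def by (subst AE_distr_iff) auto

lemma scaleC_measurable [measurable (raw)]:
  fixes f :: "'b \<Rightarrow> 'a::separable_complex_hilbert_space"
  assumes [measurable]: "c \<in> borel_measurable M" "f \<in> borel_measurable M"
  shows "(\<lambda>x. c x *\<^sub>C f x) \<in> borel_measurable M"
  by (rule borel_measurable_continuous_Pair [OF assms])
    (intro bounded_bilinear.continuous_on [OF bounded_bilinear_scaleC] continuous_intros)

lemma cinner_measurable [measurable (raw)]: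
  fixes f g :: "'b \<Rightarrow> 'a::separable_complex_hilbert_space"
  assumes [measurable]: "f \<in> borel_measurable M" "g \<in> borel_measurable M"
  shows "(\<lambda>x. cinner (f x) (g x)) \<in> borel_measurable M"
  by (rule borel_measurable_continuous_Pair [OF assms])
    (intro bounded_bilinear.continuous_on [OF bounded_bilinear_cinner] continuous_intros)

lemma hardy_fun_measurable: "hardy_fun f \<Longrightarrow> f \<in> borel_measurable circle_measure"
  by (simp add: hardy_fun_def)

lemma square_integrable_imp_integrable:
  fixes f :: "complex \<Rightarrow> 'a::separable_complex_hilbert_space"
  assumes [measurable]: "f \<in> borel_measurable circle_measure"
    and "integrable circle_measure (\<lambda>z. (norm (f z))\<^sup>2)"
  shows "integrable circle_measure (\<lambda>z. z ^ n *\<^sub>C f z)"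
proof (rule Bochner_Integration.integrable_bound)
  show "integrable circle_measure (\<lambda>z. 1 + (norm (f z))\<^sup>2)"
    using assms(2) by simp
  have *: "t \<le> 1 + t\<^sup>2" for t :: real
    using zero_le_power2 [of "t - 1/2"] by (simp add: power2_eq_square algebra_simps)
  show "AE z in circle_measure. norm (z ^ n *\<^sub>C f z) \<le> norm (1 + (norm (f z))\<^sup>2)"
    using AE_circle_cmod by eventually_elim (use * in \<open>simp add: norm_scaleC norm_power\<close>)
  show "(\<lambda>z. z ^ n *\<^sub>C f z) \<in> borel_measurable circle_measure" by measurable
qed

lemma hardy_fun_integrable:
  "hardy_fun f \<Longrightarrow> integrable circle_measure (\<lambda>z. z ^ n *\<^sub>C f z)"
  by (auto simp: hardy_fun_def intro: square_integrable_imp_integrable)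

lemma hardy_fun_cinner_integrable:
  assumes "hardy_fun f" "hardy_fun g"
  shows "integrable circle_measure (\<lambda>z. cinner (f z) (g z))"
proof (rule Bochner_Integration.integrable_bound)
  note [measurable] = assms [THEN hardy_fun_measurable]
  show "integrable circle_measure (\<lambda>z. (norm (f z))\<^sup>2 + (norm (g z))\<^sup>2)"
    using assms by (simp add: hardy_fun_def)
  have "cmod (cinner (f z) (g z)) \<le> (norm (f z))\<^sup>2 + (norm (g z))\<^sup>2" for z
    using cmod_cinner_le [of "f z" "g z"] sum_squares_bound [of "norm (f z)" "norm (g z)"]
    by simp
  then show "AE z in circle_measure.
      norm (cinner (f z) (g z)) \<le> norm ((norm (f z))\<^sup>2 + (norm (g z))\<^sup>2)" by simp
  show "(\<lambda>z. cinner (f z) (g z)) \<in> borel_measurable circle_measure" by measurable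
qed

lemma hardy_fun_zero: "hardy_fun (\<lambda>z. 0)"
  by (simp add: hardy_fun_def bounded_bilinear.zero_right [OF bounded_bilinear_scaleC])

lemma hardy_fun_add:
  assumes "hardy_fun f" "hardy_fun g"
  shows "hardy_fun (\<lambda>z. f z + g z)"
proof -
  note [measurable] = assms [THEN hardy_fun_measurable]
  have "integrable circle_measure (\<lambda>z. (norm (f z + g z))\<^sup>2)"
  proof (rule Bochner_Integration.integrable_bound)
    show "integrable circle_measure (\<lambda>z. 2 * (norm (f z))\<^sup>2 + 2 * (norm (g z))\<^sup>2)"
      using assms by (simp add: hardy_fun_def)
    have "(norm (x + y))\<^sup>2 \<le> 2 * (norm x)\<^sup>2 + 2 * (norm y)\<^sup>2" for x y :: 'a
      using power_mono [OF norm_triangle_ineq [of x y], of 2] sum_squares_bound [of "norm x" "norm y"]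
      by (simp add: power2_sum)
    then show "AE z in circle_measure.
        norm ((norm (f z + g z))\<^sup>2) \<le> norm (2 * (norm (f z))\<^sup>2 + 2 * (norm (g z))\<^sup>2)" by simp
  qed measurable
  with assms show ?thesis
    by (simp add: hardy_fun_def scaleC_add_right
        Bochner_Integration.integral_add assms [THEN hardy_fun_integrable])
qed

lemma bounded_clinear_scaleC: "bounded_clinear (\<lambda>x. a *\<^sub>C x)"
  by (simp add: bounded_clinear_def scaleC_scaleC mult.commute
      bounded_bilinear.bounded_linear_right [OF bounded_bilinear_scaleC])

lemma hardy_fun_operator:
  fixes f :: "complex \<Rightarrow> 'a::separable_complex_hilbert_space"
    and A :: "'a \<Rightarrow> 'b::separable_complex_hilbert_space"
  assumes A: "bounded_clinear A" and f: "hardy_fun f"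
  shows "hardy_fun (\<lambda>z. A (f z))"
proof -
  have bl: "bounded_linear A" and sc: "\<And>a x. A (a *\<^sub>C x) = a *\<^sub>C A x"
    using A by (auto simp: bounded_clinear_def)
  note [measurable] = hardy_fun_measurable [OF f]
  have [measurable]: "A \<in> borel_measurable borel"
    by (intro borel_measurable_continuous_onI linear_continuous_on bl)
  obtain K where K: "\<And>x. norm (A x) \<le> norm x * K"
    using bounded_linear.bounded [OF bl] by blast
  have "integrable circle_measure (\<lambda>z. (norm (A (f z)))\<^sup>2)"
  proof (rule Bochner_Integration.integrable_bound)
    show "integrable circle_measure (\<lambda>z. K\<^sup>2 * (norm (f z))\<^sup>2)"
      using f by (simp add: hardy_fun_def)
    have "(norm (A x))\<^sup>2 \<le> K\<^sup>2 * (norm x)\<^sup>2" for x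
      using power_mono [OF K [of x], of 2] by (simp add: power_mult_distrib mult.commute)
    then show "AE z in circle_measure. norm ((norm (A (f z)))\<^sup>2) \<le> norm (K\<^sup>2 * (norm (f z))\<^sup>2)"
      by simp
  qed measurable
  moreover have "(\<integral>z. z ^ n *\<^sub>C A (f z) \<partial>circle_measure)
      = A (\<integral>z. z ^ n *\<^sub>C f z \<partial>circle_measure)" for n
    unfolding sc [symmetric]
    by (rule integral_bounded_linear [OF bl hardy_fun_integrable [OF f]])
  ultimately show ?thesis
    using f by (simp add: hardy_fun_def linear_0 [OF bounded_linear.linear [OF bl]])
qed

lemma hardy_fun_shift:
  assumes f: "hardy_fun f"
  shows "hardy_fun (\<lambda>z. z *\<^sub>C f z)"
proof -
  note [measurable] = hardy_fun_measurable [OF f]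
  have "integrable circle_measure (\<lambda>z. (norm (z *\<^sub>C f z))\<^sup>2) \<longleftrightarrow>
        integrable circle_measure (\<lambda>z. (norm (f z))\<^sup>2)"
    by (rule integrable_cong_AE; (measurable)?) (use AE_circle_cmod in eventually_elim, simp add: norm_scaleC)
  moreover have "z ^ n *\<^sub>C z *\<^sub>C f z = z ^ Suc n *\<^sub>C f z" for z n
    by (simp add: scaleC_scaleC mult.commute)
  ultimately show ?thesis
    using f by (auto simp: hardy_fun_def simp del: power_Suc)
qed

lemma part_equivp_hardy_rel: "part_equivp hardy_rel"
proof (rule part_equivpI)
  show "\<exists>f. hardy_rel f f"
    using hardy_fun_zero by (auto simp: hardy_rel_def)
  show "symp hardy_rel"
    by (auto simp: symp_def hardy_rel_def elim: eventually_mono)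
  show "transp hardy_rel"
    unfolding transp_def hardy_rel_def by (blast intro: eventually_elim2 [where R = "\<lambda>z. _ z = _ z"] dest: sym trans)
qed

quotient_type (overloaded) 'a hardy =
    "complex \<Rightarrow> 'a::separable_complex_hilbert_space" / partial: hardy_rel
  by (rule part_equivp_hardy_rel)

instantiation hardy :: (separable_complex_hilbert_space) complex_inner
begin

lift_definition zero_hardy :: "'a hardy" is "\<lambda>z. 0"
  by (simp add: hardy_rel_def hardy_fun_zero)

lift_definition plus_hardy :: "'a hardy \<Rightarrow> 'a hardy \<Rightarrow> 'a hardy" is "\<lambda>f g z. f z + g z"
  by (auto simp: hardy_rel_def hardy_fun_add elim: eventually_elim2)

lift_definition scaleC_hardy :: "complex \<Rightarrow> 'a hardy \<Rightarrow> 'a hardy" is "\<lambda>a f z. a *\<^sub>C f z"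
  by (auto simp: hardy_rel_def hardy_fun_operator [OF bounded_clinear_scaleC] elim: eventually_mono)

definition scaleR_hardy :: "real \<Rightarrow> 'a hardy \<Rightarrow> 'a hardy" where
  "scaleR_hardy r f = complex_of_real r *\<^sub>C f"

definition uminus_hardy :: "'a hardy \<Rightarrow> 'a hardy" where
  "uminus_hardy f = (- 1) *\<^sub>C f"

definition minus_hardy :: "'a hardy \<Rightarrow> 'a hardy \<Rightarrow> 'a hardy" where
  "minus_hardy f g = f + (- g)"

lift_definition cinner_hardy :: "'a hardy \<Rightarrow> 'a hardy \<Rightarrow> complex" is
  "\<lambda>f g. \<integral>z. cinner (f z) (g z) \<partial>circle_measure"
  unfolding hardy_rel_def
  by (intro integral_cong_AE cinner_measurable hardy_fun_measurable) (auto elim: eventually_elim2)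

definition inner_hardy :: "'a hardy \<Rightarrow> 'a hardy \<Rightarrow> real" where
  "inner_hardy f g = Re (cinner f g)"

definition norm_hardy :: "'a hardy \<Rightarrow> real" where
  "norm_hardy f = sqrt (inner f f)"

definition sgn_hardy :: "'a hardy \<Rightarrow> 'a hardy" where
  "sgn_hardy f = inverse (norm f) *\<^sub>R f"

definition dist_hardy :: "'a hardy \<Rightarrow> 'a hardy \<Rightarrow> real" where
  "dist_hardy f g = norm (f - g)"

definition uniformity_hardy :: "('a hardy \<times> 'a hardy) filter" where
  "uniformity_hardy = (INF e\<in>{0<..}. principal {(f, g). dist f g < e})"

definition open_hardy :: "'a hardy set \<Rightarrow> bool" where
  "open_hardy S \<longleftrightarrow> (\<forall>f\<in>S. \<forall>\<^sub>F (f', g) in uniformity. f' = f \<longrightarrow> g \<in> S)"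

instance
proof
  fix f g h :: "'a hardy" and a b :: complex and r s :: real
  show sa: "a *\<^sub>C b *\<^sub>C f = (a * b) *\<^sub>C f" for a b and f :: "'a hardy"
    by transfer (simp add: hardy_rel_def scaleC_scaleC hardy_fun_operator [OF bounded_clinear_scaleC])
  show ar: "a *\<^sub>C (f + g) = a *\<^sub>C f + a *\<^sub>C g" for a and f g :: "'a hardy"
    by transfer (simp add: hardy_rel_def scaleC_add_right hardy_fun_add
        hardy_fun_operator [OF bounded_clinear_scaleC])
  show al: "(a + b) *\<^sub>C f = a *\<^sub>C f + b *\<^sub>C f" for a b and f :: "'a hardy"
    by transfer (simp add: hardy_rel_def scaleC_add_left hardy_fun_add
        hardy_fun_operator [OF bounded_clinear_scaleC])
  have one: "1 *\<^sub>C f = f" for f :: "'a hardy"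
    by transfer (simp add: hardy_rel_def scaleC_one)
  have zero: "0 *\<^sub>C f = 0" for f :: "'a hardy"
    by transfer (simp add: hardy_rel_def scaleC_zero hardy_fun_zero)
  show "f + g + h = f + (g + h)"
    by transfer (simp add: hardy_rel_def hardy_fun_add add.assoc)
  show "f + g = g + f"
    by transfer (simp add: hardy_rel_def hardy_fun_add add.commute)
  show "0 + f = f"
    by transfer (simp add: hardy_rel_def)
  show "- f + f = 0"
    using al [of "- 1" 1 f] by (simp add: uminus_hardy_def one zero)
  show "f - g = f + - g" by (rule minus_hardy_def)
  show "r *\<^sub>R (f + g) = r *\<^sub>R f + r *\<^sub>R g" by (simp add: scaleR_hardy_def ar)
  show "(r + s) *\<^sub>R f = r *\<^sub>R f + s *\<^sub>R f" by (simp add: scaleR_hardy_def al)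
  show "r *\<^sub>R s *\<^sub>R f = (r * s) *\<^sub>R f" by (simp add: scaleR_hardy_def sa)
  show "1 *\<^sub>R f = f" by (simp add: scaleR_hardy_def one)
  show "complex_of_real r *\<^sub>C f = r *\<^sub>R f" by (simp add: scaleR_hardy_def)
  show cc: "cinner f g = cnj (cinner g f)" for f g :: "'a hardy"
    by transfer (simp only: Bochner_Integration.integral_cnj [symmetric] cinner_commute [symmetric])
  show ca: "cinner (f + g) h = cinner f h + cinner g h"
    by transfer (simp add: hardy_rel_def cinner_add_left hardy_fun_cinner_integrable)
  show cs: "cinner (a *\<^sub>C f) g = a * cinner f g" for a and f g :: "'a hardy"
    by transfer (simp add: cinner_scaleC_left)
  show "Re (cinner f g) = inner f g" by (simp add: inner_hardy_def)
  show "inner f g = inner g f"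
    using cc [of f g] by (simp add: inner_hardy_def)
  show "inner (f + g) h = inner f h + inner g h" by (simp add: inner_hardy_def ca)
  show "inner (r *\<^sub>R f) g = r * inner f g" by (simp add: inner_hardy_def scaleR_hardy_def cs)
  have self: "Re (\<integral>z. cinner (f z) (f z) \<partial>circle_measure) = (\<integral>z. (norm (f z))\<^sup>2 \<partial>circle_measure)"
    if "hardy_fun f" for f :: "complex \<Rightarrow> 'a"
    using that by (simp add: Bochner_Integration.integral_Re [symmetric] hardy_fun_cinner_integrable Re_cinner power2_norm_eq_inner)
  show "0 \<le> inner f f"
    unfolding inner_hardy_def by transfer (simp add: hardy_rel_def self)
  show "inner f f = 0 \<longleftrightarrow> f = 0"
    unfolding inner_hardy_def
  proof transfer
    fix f :: "complex \<Rightarrow> 'a" assume "hardy_rel f f"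
    then have f: "hardy_fun f" by (simp add: hardy_rel_def)
    then have "(\<integral>z. (norm (f z))\<^sup>2 \<partial>circle_measure) = 0 \<longleftrightarrow>
        (AE z in circle_measure. (norm (f z))\<^sup>2 = 0)"
      by (intro integral_nonneg_eq_0_iff_AE) (auto simp: hardy_fun_def)
    then show "Re (\<integral>z. cinner (f z) (f z) \<partial>circle_measure) = 0 \<longleftrightarrow> hardy_rel f (\<lambda>z. 0)"
      using f by (simp add: self hardy_rel_def hardy_fun_zero)
  qed
  show "norm f = sqrt (inner f f)" by (rule norm_hardy_def)
  show "sgn f = inverse (norm f) *\<^sub>R f" by (rule sgn_hardy_def)
  show "dist f g = norm (f - g)" by (rule dist_hardy_def)
  show "uniformity = (INF e\<in>{0<..}. principal {(f :: 'a hardy, g). dist f g < e})"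
    by (rule uniformity_hardy_def)
  show "open S \<longleftrightarrow> (\<forall>f\<in>S. \<forall>\<^sub>F (f', g) in uniformity. f' = f \<longrightarrow> g \<in> S)" for S :: "'a hardy set"
    by (rule open_hardy_def)
qed

end

section \<open>BCL pairs\<close>

text \<open>
  Under the identification of the vector-valued Hardy space with the Hilbert space tensor product
  of the scalar Hardy space and \<open>\<S>\<close>, the operator \<open>I \<otimes> A\<close> sends
  \<open>f\<close> to \<open>z \<mapsto> A (f z)\<close> and \<open>S\<^sub>z \<otimes> A\<close> sends it to
  \<open>z \<mapsto> z \<cdot> A (f z)\<close>.  Both are well-defined for every bounded
  complex-linear \<open>A\<close>, by the lemmas below.
\<close>

definition id_tensor ::
    "('a::separable_complex_hilbert_space \<Rightarrow> 'a) \<Rightarrow> 'a hardy \<Rightarrow> 'a hardy" where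
  "id_tensor A f = abs_hardy (\<lambda>z. A (rep_hardy f z))"

definition shift_tensor ::
    "('a::separable_complex_hilbert_space \<Rightarrow> 'a) \<Rightarrow> 'a hardy \<Rightarrow> 'a hardy" where
  "shift_tensor A f = abs_hardy (\<lambda>z. z *\<^sub>C A (rep_hardy f z))"

lemma hardy_rel_rep_abs: "hardy_fun f \<Longrightarrow> hardy_rel (rep_hardy (abs_hardy f)) f"
  by (rule Quotient3_rep_abs [OF Quotient3_hardy]) (simp add: hardy_rel_def)

lemma id_tensor_abs_hardy:
  assumes "bounded_clinear A" "hardy_fun f"
  shows "id_tensor A (abs_hardy f) = abs_hardy (\<lambda>z. A (f z))"
  unfolding id_tensor_def
  by (rule Quotient3_rel_abs [OF Quotient3_hardy])
    (use hardy_rel_rep_abs [OF assms(2)] in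
      \<open>auto simp: hardy_rel_def hardy_fun_operator [OF assms(1)] elim: eventually_mono\<close>)

lemma shift_tensor_abs_hardy:
  assumes "bounded_clinear A" "hardy_fun f"
  shows "shift_tensor A (abs_hardy f) = abs_hardy (\<lambda>z. z *\<^sub>C A (f z))"
  unfolding shift_tensor_def
  by (rule Quotient3_rel_abs [OF Quotient3_hardy])
    (use hardy_rel_rep_abs [OF assms(2)] in
      \<open>auto simp: hardy_rel_def hardy_fun_shift hardy_fun_operator [OF assms(1)] elim: eventually_mono\<close>)

definition bcl_triple :: "('a::separable_complex_hilbert_space \<Rightarrow> 'a) \<Rightarrow> ('a \<Rightarrow> 'a) \<Rightarrow> bool" where
  "bcl_triple U P \<longleftrightarrow> unitary_op U \<and> orthogonal_projection P"

definition orth_compl :: "('a::complex_inner \<Rightarrow> 'a) \<Rightarrow> 'a \<Rightarrow> 'a" where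
  "orth_compl P x = x - P x"

definition bcl_fst ::
    "('a::separable_complex_hilbert_space \<Rightarrow> 'a) \<Rightarrow> ('a \<Rightarrow> 'a) \<Rightarrow> 'a hardy \<Rightarrow> 'a hardy" where
  "bcl_fst U P f =
     id_tensor (P \<circ> cadjoint U) f + shift_tensor (orth_compl P \<circ> cadjoint U) f"

definition bcl_snd ::
    "('a::separable_complex_hilbert_space \<Rightarrow> 'a) \<Rightarrow> ('a \<Rightarrow> 'a) \<Rightarrow> 'a hardy \<Rightarrow> 'a hardy" where
  "bcl_snd U P f = id_tensor (U \<circ> orth_compl P) f + shift_tensor (U \<circ> P) f"

definition pair_defect ::
    "('a::complex_inner \<Rightarrow> 'a) \<Rightarrow> ('a \<Rightarrow> 'a) \<Rightarrow> 'a \<Rightarrow> 'a" where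
  "pair_defect V W x =
     W (cadjoint W x) - V (cadjoint V x)
       - W (W (cadjoint W (cadjoint W x))) + V (W (cadjoint V (cadjoint W x)))"

end

(*
  Both operators V1, V2 of the pair are explicit in terms of the shift S, and V1 V2 = V2 V1 = S.
  Hence the defect equals V2 W V2^* - V1 W V1^*, where W = I - V2 V2^* is the projection onto the
  constant functions with values in the range of U P U^*.  It therefore lives on the Fourier
  coefficients of index 0 and 1, where it is a 2 x 2 block operator.  With T = P U P, its lower right
  block is U T T^* U^*, whose compactness is equivalent to that of T (a bounded operator between
  Hilbert spaces is compact as soon as A^* A is).  If T is compact, then so are the off-diagonal
  blocks, and the upper left block differs from (U^2 P - P U^2) U^*^2 by a compact operator.
*)

theory Submission
  imports Defs
begin

section \<open>Operators and formal adjoints\<close>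

lemma bounded_clinear_imp_bounded_linear: "bounded_clinear T \<Longrightarrow> bounded_linear T"
  by (simp add: bounded_clinear_def)

lemma
  assumes "bounded_clinear T"
  shows bounded_clinear_add: "T (x + y) = T x + T y"
    and bounded_clinear_diff: "T (x - y) = T x - T y"
    and bounded_clinear_0: "T 0 = 0"
    and bounded_clinear_scale: "T (a *\<^sub>C x) = a *\<^sub>C T x"
  using assms
  by (simp_all add: bounded_clinear_def linear_add linear_diff linear_0 bounded_linear.linear)

lemma bounded_clinear_compose:
  "bounded_clinear S \<Longrightarrow> bounded_clinear T \<Longrightarrow> bounded_clinear (\<lambda>x. S (T x))"
  by (simp add: bounded_clinear_def bounded_linear_compose)

lemma bounded_clinear_plus:
  "bounded_clinear S \<Longrightarrow> bounded_clinear T \<Longrightarrow> bounded_clinear (\<lambda>x. S x + T x)"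
  by (simp add: bounded_clinear_def bounded_linear_add scaleC_add_right)

lemma scaleC_minus_right: "a *\<^sub>C (x - y) = a *\<^sub>C x - a *\<^sub>C y"
  by (rule bounded_bilinear.diff_right [OF bounded_bilinear_scaleC])

lemma bounded_clinear_minus:
  "bounded_clinear S \<Longrightarrow> bounded_clinear T \<Longrightarrow> bounded_clinear (\<lambda>x. S x - T x)"
  by (simp add: bounded_clinear_def bounded_linear_sub scaleC_minus_right)

lemma bounded_clinear_orth_compl:
  assumes "bounded_clinear P"
  shows "bounded_clinear (orth_compl P)"
proof -
  have "bounded_clinear (\<lambda>x. x)"
    by (simp add: bounded_clinear_def bounded_linear_ident)
  from bounded_clinear_minus [OF this assms] show ?thesis
    by (simp add: orth_compl_def [abs_def])
qed

lemma cinner_eqI: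
  fixes y z :: "'a::complex_inner"
  assumes "\<And>x. cinner x y = cinner x z"
  shows "y = z"
proof -
  have "inner (y - z) y = inner (y - z) z"
    using assms [of "y - z"] by (simp add: Re_cinner [symmetric])
  then have "inner (y - z) (y - z) = 0" by (simp add: inner_diff_right)
  then show ?thesis by simp
qed

lemma norm_le_of_inner_le:
  fixes x :: "'a::real_inner"
  assumes "inner x x \<le> norm x * c" "0 \<le> c"
  shows "norm x \<le> c"
proof (cases "x = 0")
  case False
  have "norm x * norm x \<le> norm x * c"
    using assms(1) by (simp add: power2_norm_eq_inner [symmetric] power2_eq_square)
  with False show ?thesis by simp
qed (simp add: assms)

text \<open>A relation in place of the description inside \<open>cadjoint\<close>: adjoints are
  exhibited by explicit formulas and identified through \<open>cadjoint_eqI\<close>, so their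
  existence never has to come from completeness of the Hardy space.\<close>

definition adjoint_pair :: "('a::complex_inner \<Rightarrow> 'b::complex_inner) \<Rightarrow> ('b \<Rightarrow> 'a) \<Rightarrow> bool" where
  "adjoint_pair T T' \<longleftrightarrow> (\<forall>x y. cinner (T x) y = cinner x (T' y))"

lemma adjoint_pairI: "(\<And>x y. cinner (T x) y = cinner x (T' y)) \<Longrightarrow> adjoint_pair T T'"
  by (simp add: adjoint_pair_def)

lemma adjoint_pairD: "adjoint_pair T T' \<Longrightarrow> cinner (T x) y = cinner x (T' y)"
  by (simp add: adjoint_pair_def)

lemma adjoint_pair_sym: "adjoint_pair T T' \<Longrightarrow> adjoint_pair T' T"
  unfolding adjoint_pair_def by (metis cinner_commute)

lemma adjoint_pair_unique:
  assumes "adjoint_pair T T'" "adjoint_pair T T''"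
  shows "T' = T''"
  by (rule ext, rule cinner_eqI) (simp add: assms [THEN adjoint_pairD, symmetric])

lemma cadjoint_eqI: "adjoint_pair T T' \<Longrightarrow> cadjoint T = T'"
  unfolding cadjoint_def
  by (rule the_equality) (auto simp: adjoint_pair_def intro!: adjoint_pair_unique [of T])

lemma adjoint_pair_compose:
  "adjoint_pair S S' \<Longrightarrow> adjoint_pair T T' \<Longrightarrow> adjoint_pair (\<lambda>x. S (T x)) (\<lambda>y. T' (S' y))"
  by (simp add: adjoint_pair_def)

lemma adjoint_pair_plus:
  "adjoint_pair S S' \<Longrightarrow> adjoint_pair T T' \<Longrightarrow> adjoint_pair (\<lambda>x. S x + T x) (\<lambda>y. S' y + T' y)"
  by (simp add: adjoint_pair_def cinner_add_left cinner_add_right)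

text \<open>Testing against all vectors gives linearity, and ||T' y||^2 = <T T' y, y> <= K ||T' y||
  ||y|| gives the bound after cancelling a factor ||T' y||.\<close>

lemma adjoint_pair_bounded_clinear:
  assumes T: "bounded_clinear T" and adj: "adjoint_pair T T'"
  shows "bounded_clinear T'"
proof -
  have eq: "cinner x (T' y) = cinner (T x) y" for x y
    using adjoint_pairD [OF adj] by simp
  obtain K where K: "K \<ge> 0" "\<And>x. norm (T x) \<le> norm x * K"
    using bounded_linear.nonneg_bounded [OF bounded_clinear_imp_bounded_linear [OF T]] by blast
  have add: "T' (x + y) = T' x + T' y" for x y
    by (rule cinner_eqI) (simp add: eq cinner_add_right)
  have scale: "T' (a *\<^sub>C x) = a *\<^sub>C T' x" for a x
    by (rule cinner_eqI) (simp add: eq cinner_scaleC_right)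
  have bound: "norm (T' y) \<le> norm y * K" for y
  proof (rule norm_le_of_inner_le)
    have "inner (T' y) (T' y) = inner (T (T' y)) y"
      by (simp only: Re_cinner [symmetric] eq)
    also have "\<dots> \<le> norm (T (T' y)) * norm y" by (rule norm_cauchy_schwarz)
    also have "\<dots> \<le> (norm (T' y) * K) * norm y" by (intro mult_right_mono K norm_ge_zero)
    finally show "inner (T' y) (T' y) \<le> norm (T' y) * (norm y * K)" by (simp add: ac_simps)
  qed (simp add: K)
  have "bounded_linear T'"
  proof (rule bounded_linear_intro)
    show "T' (r *\<^sub>R x) = r *\<^sub>R T' x" for r x
      using scale [of "complex_of_real r" x] by (simp only: scaleC_of_real)
  qed (fact add bound)+
  with scale show ?thesis by (simp add: bounded_clinear_def)
qed

text \<open>Serves \<open>shift\<close> and \<open>const_hardy\<close>; their adjoints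
  \<open>backshift\<close> and \<open>mean\<close> then inherit boundedness from
  \<open>adjoint_pair_bounded_clinear\<close>.\<close>

lemma isometric_bounded_clinear:
  assumes "\<And>x y. T (x + y) = T x + T y" "\<And>a x. T (a *\<^sub>C x) = a *\<^sub>C T x"
    and "\<And>x. cinner (T x) (T x) = cinner x x"
  shows "bounded_clinear T"
proof -
  have norm: "norm (T x) = norm x" for x
    by (simp add: norm_eq_sqrt_inner Re_cinner [symmetric] assms(3))
  have "bounded_linear T"
  proof (rule bounded_linear_intro [where K = 1])
    show "T (r *\<^sub>R x) = r *\<^sub>R T x" for r x
      using assms(2) [of "complex_of_real r" x] by (simp only: scaleC_of_real)
  qed (simp_all add: assms(1) norm)
  with assms(2) show ?thesis by (simp add: bounded_clinear_def)
qed

section \<open>Compact operators\<close>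

text \<open>A closed subset of a compact set is compact, so any compact superset of the image will
  do, and the permanence properties below need no computation of closures.\<close>

lemma compact_op_iff:
  "compact_op T \<longleftrightarrow> bounded_clinear T \<and> (\<exists>K. compact K \<and> T ` cball 0 1 \<subseteq> K)"
proof -
  have "compact (closure (T ` cball 0 1))" if K: "compact K" "T ` cball 0 1 \<subseteq> K" for K
  proof -
    have "closure (T ` cball 0 1) \<subseteq> K"
      by (rule closure_minimal [OF K(2) compact_imp_closed [OF K(1)]])
    then have "K \<inter> closure (T ` cball 0 1) = closure (T ` cball 0 1)" by blast
    with compact_Int_closed [OF K(1) closed_closure [of "T ` cball 0 1"]] show ?thesis by simp
  qed
  moreover have "T ` cball 0 1 \<subseteq> closure (T ` cball 0 1)" by (rule closure_subset)
  ultimately show ?thesis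
    unfolding compact_op_def by blast
qed

lemma compact_op_imp_bounded_clinear: "compact_op T \<Longrightarrow> bounded_clinear T"
  by (simp add: compact_op_def)

lemma compact_op_plus:
  assumes "compact_op S" "compact_op T"
  shows "compact_op (\<lambda>x. S x + T x)"
proof -
  obtain K L where "compact K" "S ` cball 0 1 \<subseteq> K" "compact L" "T ` cball 0 1 \<subseteq> L"
    using assms by (auto simp: compact_op_iff)
  then have "compact {x + y | x y. x \<in> K \<and> y \<in> L}"
    "(\<lambda>x. S x + T x) ` cball 0 1 \<subseteq> {x + y | x y. x \<in> K \<and> y \<in> L}"
    by (blast intro: compact_sums)+
  then show ?thesis
    using assms bounded_clinear_plus compact_op_imp_bounded_clinear
    unfolding compact_op_iff by blast
qed

lemma compact_op_compose_left:
  assumes A: "bounded_clinear A" and T: "compact_op T"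
  shows "compact_op (\<lambda>x. A (T x))"
proof -
  obtain K where K: "compact K" "T ` cball 0 1 \<subseteq> K"
    using T by (auto simp: compact_op_iff)
  have "compact (A ` K)"
    by (intro compact_continuous_image linear_continuous_on bounded_clinear_imp_bounded_linear A K)
  moreover have "(\<lambda>x. A (T x)) ` cball 0 1 \<subseteq> A ` K" using K(2) by blast
  ultimately show ?thesis
    using bounded_clinear_compose [OF A compact_op_imp_bounded_clinear [OF T]]
    unfolding compact_op_iff by blast
qed

text \<open>\<open>B\<close> maps the unit ball into the ball of radius \<open>c\<close>, so scaling
  \<open>K\<close> by \<open>c\<close> catches the image.\<close>

lemma compact_op_compose_right:
  assumes B: "bounded_clinear B" and T: "compact_op T"
  shows "compact_op (\<lambda>x. T (B x))"
proof -
  obtain K where K: "compact K" "T ` cball 0 1 \<subseteq> K"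
    using T by (auto simp: compact_op_iff)
  obtain c where c: "c > 0" "\<And>x. norm (B x) \<le> norm x * c"
    using bounded_linear.pos_bounded [OF bounded_clinear_imp_bounded_linear [OF B]] by blast
  have bl: "bounded_linear T"
    by (intro bounded_clinear_imp_bounded_linear compact_op_imp_bounded_clinear T)
  have "T (B x) \<in> (*\<^sub>R) c ` K" if "x \<in> cball 0 1" for x
  proof -
    have "norm (B x) \<le> norm x * c" by (rule c)
    also have "\<dots> \<le> 1 * c" using c(1) that by (intro mult_right_mono) auto
    finally have "norm (B x) \<le> c" by simp
    with c(1) have "inverse c *\<^sub>R B x \<in> cball 0 1"
      by (simp add: field_simps)
    with K(2) have "T (inverse c *\<^sub>R B x) \<in> K" by blast
    moreover have "T (B x) = c *\<^sub>R T (inverse c *\<^sub>R B x)"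
      using c(1) by (simp add: linear_scale [OF bounded_linear.linear [OF bl]])
    ultimately show ?thesis by blast
  qed
  moreover have "compact ((*\<^sub>R) c ` K)" by (rule compact_scaling [OF K(1)])
  ultimately show ?thesis
    using bounded_clinear_compose [OF compact_op_imp_bounded_clinear [OF T] B]
    unfolding compact_op_iff by blast
qed

lemma compact_op_minus:
  assumes "compact_op S" "compact_op T"
  shows "compact_op (\<lambda>x. S x - T x)"
proof -
  have "(- 1) *\<^sub>C x = - x" for x :: 'b
    using scaleC_of_real [of "- 1" x] by simp
  with compact_op_plus [OF assms(1) compact_op_compose_left [OF bounded_clinear_scaleC [of "- 1"] assms(2)]]
  show ?thesis by simp
qed

text \<open>
  \<open>\<parallel>T (x - y)\<parallel>\<^sup>2 \<le> \<parallel>T' T (x - y)\<parallel> \<parallel>x - y\<parallel>\<close>, so finite nets for the image of the unit ball under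
  \<open>T' T\<close> yield finite nets for its image under \<open>T\<close>.
\<close>

lemma compact_op_of_adjoint_compose:
  fixes T :: "'a::complex_inner \<Rightarrow> 'b::complex_hilbert_space"
  assumes T: "bounded_clinear T" and adj: "adjoint_pair T T'"
    and comp: "compact_op (\<lambda>x. T' (T x))"
  shows "compact_op T"
proof -
  let ?B = "cball 0 1 :: 'a set"
  have cl: "compact (closure ((\<lambda>x. T' (T x)) ` ?B))"
    using comp by (simp add: compact_op_def)
  have "\<exists>k. finite k \<and> closure (T ` ?B) \<subseteq> (\<Union>y\<in>k. ball y e)" if e: "e > 0" for e :: real
  proof -
    \<comment> \<open>Two points of the unit ball differ by at most 2 in norm, so a
      \<open>?d\<close>-net for \<open>T' T\<close> leaves a squared error of at most 2 *
      \<open>?d\<close> <= (e/2)^2 for \<open>T\<close>. The other e/2 pays for passing to the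
      closure.\<close>
    let ?d = "e\<^sup>2 / 16"
    let ?S = "(\<lambda>x. T' (T x)) ` ?B"
    have d: "?d > 0" using e by simp
    \<comment> \<open>The centres are taken in the image itself, so that a finite subcover pulls
      back to a finite set \<open>G\<close> of points of the unit ball.\<close>
    have net: "closure ?S \<subseteq> (\<Union>y\<in>?S. ball y ?d)"
    proof
      fix y assume "y \<in> closure ?S"
      with d obtain s where "s \<in> ?S" "dist s y < ?d"
        unfolding closure_approachable by blast
      then show "y \<in> (\<Union>y\<in>?S. ball y ?d)" unfolding mem_ball UN_iff by blast
    qed
    obtain F where F: "F \<subseteq> ?S" "finite F" "closure ?S \<subseteq> (\<Union>y\<in>F. ball y ?d)"
      by (rule compactE_image [OF cl open_ball net])
    obtain G where G: "finite G" "G \<subseteq> ?B" "F = (\<lambda>x. T' (T x)) ` G"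
      using finite_subset_image [OF F(2,1)] by (elim exE conjE) (rule that)
    have near: "\<exists>g\<in>G. dist (T g) (T x) \<le> e / 2" if x: "x \<in> ?B" for x
    proof -
      have "T' (T x) \<in> closure ?S" by (rule subsetD [OF closure_subset imageI [OF x]])
      from subsetD [OF F(3) this] obtain y where y: "y \<in> F" "T' (T x) \<in> ball y ?d" by (rule UN_E)
      from y(1) obtain g where "g \<in> G" "y = T' (T g)" unfolding G(3) by (rule imageE)
      with y(2) have g: "g \<in> G" "dist (T' (T g)) (T' (T x)) < ?d" by (simp_all only: mem_ball)
      let ?w = "g - x"
      have "norm g \<le> 1" "norm x \<le> 1" using G(2) g(1) x by auto
      then have "norm ?w \<le> 2"
        using norm_triangle_ineq4 [of g x] by linarith
      have T'w: "T' (T ?w) = T' (T g) - T' (T x)"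
        using adjoint_pair_bounded_clinear [OF T adj] T by (simp add: bounded_clinear_diff)
      have "(norm (T ?w))\<^sup>2 = inner ?w (T' (T ?w))"
        by (simp only: power2_norm_eq_inner Re_cinner [symmetric] adjoint_pairD [OF adj])
      also have "\<dots> \<le> norm ?w * norm (T' (T ?w))" by (rule norm_cauchy_schwarz)
      also have "\<dots> \<le> 2 * ?d"
        using g(2) \<open>norm ?w \<le> 2\<close> by (intro mult_mono) (simp_all add: T'w dist_norm)
      also have "\<dots> \<le> (e / 2)\<^sup>2" by (simp add: power2_eq_square)
      finally have "norm (T ?w) \<le> e / 2"
        by (rule power2_le_imp_le) (use e in simp)
      then show ?thesis
        using g(1) by (auto simp: dist_norm bounded_clinear_diff [OF T])
    qed
    have "closure (T ` ?B) \<subseteq> (\<Union>y\<in>T ` G. ball y e)"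
    proof
      fix y assume "y \<in> closure (T ` ?B)"
      moreover have "e / 2 > 0" using e by simp
      ultimately obtain x where x: "x \<in> ?B" "dist (T x) y < e / 2"
        unfolding closure_approachable by blast
      with near obtain g where "g \<in> G" "dist (T g) (T x) \<le> e / 2" by blast
      with x(2) have "dist (T g) y < e"
        using dist_triangle [of "T g" y "T x"] by simp
      with \<open>g \<in> G\<close> show "y \<in> (\<Union>y\<in>T ` G. ball y e)" by auto
    qed
    with G(1) show ?thesis by blast
  qed
  \<comment> \<open>Completeness of the codomain enters here: a closed set is complete, and total
    boundedness then gives compactness.\<close>
  then have "compact (closure (T ` ?B))"
    unfolding compact_eq_totally_bounded by (simp add: complete_eq_closed)
  with T show ?thesis by (simp add: compact_op_def)
qed

text \<open>\<open>T T'\<close> is compact because \<open>T\<close> is, and it has the form A^* A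
  for A = \<open>T'\<close>.\<close>

lemma compact_op_adjoint:
  fixes T :: "'a::complex_hilbert_space \<Rightarrow> 'b::complex_inner"
  assumes T: "compact_op T" and adj: "adjoint_pair T T'"
  shows "compact_op T'"
proof -
  have T': "bounded_clinear T'"
    by (rule adjoint_pair_bounded_clinear [OF compact_op_imp_bounded_clinear [OF T] adj])
  show ?thesis
    by (rule compact_op_of_adjoint_compose [OF T' adjoint_pair_sym [OF adj]])
      (rule compact_op_compose_right [OF T' T])
qed

section \<open>Shift, backward shift and Fourier coefficients on the Hardy space\<close>

lemma integral_circle_measure:
  fixes f :: "complex \<Rightarrow> 'a::{banach, second_countable_topology}"
  assumes [measurable]: "f \<in> borel_measurable borel"
  shows "(\<integral>z. f z \<partial>circle_measure) =
    (1 / (2 * pi)) *\<^sub>R (\<integral>t. indicator {0..2 * pi} t *\<^sub>R f (cis t) \<partial>lborel)"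
proof -
  have [measurable]: "cis \<in> borel_measurable borel"
    by (intro borel_measurable_continuous_onI continuous_intros)
  have "(\<integral>z. f z \<partial>circle_measure) = (\<integral>t. f (cis t) \<partial>uniform_measure lborel {0..2 * pi})"
    unfolding circle_measure_def by (rule integral_distr) auto
  also have "uniform_measure lborel {0..2 * pi} =
      density lborel (\<lambda>t. ennreal (indicator {0..2 * pi} t / (2 * pi)))"
    unfolding uniform_measure_def
    using divide_ennreal [of 1 "2 * pi"] by (intro density_cong) (auto simp: indicator_def)
  also have "(\<integral>t. f (cis t) \<partial>density lborel (\<lambda>t. ennreal (indicator {0..2 * pi} t / (2 * pi)))) =
      (\<integral>t. (indicator {0..2 * pi} t / (2 * pi)) *\<^sub>R f (cis t) \<partial>lborel)"
    by (rule integral_density) auto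
  also have "\<dots> = (\<integral>t. (1 / (2 * pi)) *\<^sub>R (indicator {0..2 * pi} t *\<^sub>R f (cis t)) \<partial>lborel)"
    by (rule Bochner_Integration.integral_cong) auto
  finally show ?thesis by (simp only: integral_scaleR_right)
qed

lemma integral_power_circle_measure:
  assumes "n \<ge> 1"
  shows "(\<integral>z. z ^ n \<partial>circle_measure) = 0"
proof -
  \<comment> \<open>An antiderivative of exp(int), where n >= 1 makes the division legitimate; it
    takes equal values at the endpoints by periodicity.\<close>
  let ?F = "\<lambda>t. cis (real n * t) * (1 / (\<i> * of_nat n))"
  have "(\<integral>t. indicator {0..2 * pi} t *\<^sub>R cis (real n * t) \<partial>lborel) = ?F (2 * pi) - ?F 0"
  proof (rule integral_FTC_Icc)
    fix t :: real
    show "(?F has_vector_derivative cis (real n * t)) (at t within {0..2 * pi})"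
      unfolding has_vector_derivative_def using assms
      by (auto intro!: derivative_eq_intros simp: scaleR_conv_of_real fun_eq_iff algebra_simps)
  qed (auto intro!: continuous_intros)
  also have "\<dots> = 0"
    using cis_multiple_2pi [of "real n"] by (simp add: mult.commute)
  finally have zero: "(\<integral>t. indicator {0..2 * pi} t *\<^sub>R cis (real n * t) \<partial>lborel) = 0" .
  have "(\<integral>z. z ^ n \<partial>circle_measure) =
      (1 / (2 * pi)) *\<^sub>R (\<integral>t. indicator {0..2 * pi} t *\<^sub>R cis t ^ n \<partial>lborel)"
    by (rule integral_circle_measure) measurable
  then show ?thesis
    by (simp only: Complex.DeMoivre zero scaleR_zero_right)
qed

lemma measure_circle_measure [simp]: "measure circle_measure UNIV = 1"
  by (simp add: measure_def prob_circle_measure)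

lemma hardy_fun_const: "hardy_fun (\<lambda>z. x)"
proof -
  have "(\<integral>z. z ^ n *\<^sub>C x \<partial>circle_measure) = 0" if "n \<ge> 1" for n
  proof -
    have "integrable circle_measure (\<lambda>z. z ^ n)"
    proof (rule circle.integrable_const_bound [where B = 1])
      show "AE z in circle_measure. norm (z ^ n) \<le> 1"
        using AE_circle_cmod by eventually_elim (simp add: norm_power)
    qed measurable
    then have "(\<integral>z. z ^ n *\<^sub>C x \<partial>circle_measure) = (\<integral>z. z ^ n \<partial>circle_measure) *\<^sub>C x"
      by (rule integral_bounded_linear
          [OF bounded_bilinear.bounded_linear_left [OF bounded_bilinear_scaleC]])
    with that show ?thesis by (simp add: integral_power_circle_measure scaleC_zero)
  qed
  then show ?thesis by (simp add: hardy_fun_def)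
qed

lemma hardy_fun_imp_integrable: "hardy_fun f \<Longrightarrow> integrable circle_measure f"
  using hardy_fun_integrable [of f 0] by (simp add: scaleC_one)

text \<open>On the circle \<open>cnj z\<close> is 1/z, so every Fourier coefficient moves down by
  one index. Only the coefficient of index 0 could become one of negative index, and subtracting the
  mean removes it beforehand.\<close>

lemma hardy_fun_backshift:
  assumes f: "hardy_fun f"
  shows "hardy_fun (\<lambda>z. cnj z *\<^sub>C (f z - (\<integral>w. f w \<partial>circle_measure)))"
proof -
  define g where "g z = f z - (\<integral>w. f w \<partial>circle_measure)" for z
  have g: "hardy_fun g"
    using hardy_fun_add [OF f hardy_fun_const [of "- (\<integral>w. f w \<partial>circle_measure)"]]
    by (simp add: g_def [abs_def])
  note [measurable] = hardy_fun_measurable [OF f] hardy_fun_measurable [OF g]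
  have [measurable]: "cnj \<in> borel_measurable borel"
    by (intro borel_measurable_continuous_onI continuous_intros)
  have int_g: "(\<integral>z. g z \<partial>circle_measure) = 0"
    by (simp add: g_def hardy_fun_imp_integrable [OF f])
  have "integrable circle_measure (\<lambda>z. (norm (cnj z *\<^sub>C g z))\<^sup>2) \<longleftrightarrow>
        integrable circle_measure (\<lambda>z. (norm (g z))\<^sup>2)"
    by (rule integrable_cong_AE; (measurable)?)
      (use AE_circle_cmod in eventually_elim, simp add: norm_scaleC)
  moreover have "(\<integral>z. z ^ n *\<^sub>C cnj z *\<^sub>C g z \<partial>circle_measure) = 0" if "n \<ge> 1" for n
  proof -
    obtain m where m: "n = Suc m" using \<open>n \<ge> 1\<close> by (cases n) auto
    have "(\<integral>z. z ^ n *\<^sub>C cnj z *\<^sub>C g z \<partial>circle_measure) = (\<integral>z. z ^ m *\<^sub>C g z \<partial>circle_measure)"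
    proof (rule integral_cong_AE)
      show "AE z in circle_measure. z ^ n *\<^sub>C cnj z *\<^sub>C g z = z ^ m *\<^sub>C g z"
        using AE_circle_cmod
      proof eventually_elim
        case (elim z)
        then have "z * cnj z = 1" by (simp add: complex_norm_square [symmetric])
        then have "z ^ n * cnj z = z ^ m" by (simp add: m ac_simps)
        then show ?case by (simp only: scaleC_scaleC)
      qed
    qed measurable
    also have "\<dots> = 0"
    proof (cases m)
      case 0
      with int_g show ?thesis by (simp add: scaleC_one)
    next
      case (Suc k)
      then have "m \<ge> 1" by simp
      with g show ?thesis unfolding hardy_fun_def by blast
    qed
    finally show ?thesis .
  qed
  ultimately have "hardy_fun (\<lambda>z. cnj z *\<^sub>C g z)"
    using g by (simp add: hardy_fun_def)
  then show ?thesis by (simp add: g_def)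
qed

section \<open>Shift, backward shift, constants and mean on equivalence classes\<close>

lemma hardy_cases:
  fixes f :: "'a::separable_complex_hilbert_space hardy"
  obtains g where "hardy_fun g" "f = abs_hardy g"
proof
  show "hardy_fun (rep_hardy f)"
    using Quotient3_rep_reflp [OF Quotient3_hardy, of f] by (simp add: hardy_rel_def)
  show "f = abs_hardy (rep_hardy f)"
    by (simp add: Quotient3_abs_rep [OF Quotient3_hardy])
qed

lemma hardy_rel_refl: "hardy_fun f \<Longrightarrow> hardy_rel f f"
  by (simp add: hardy_rel_def)

lemma abs_hardy_eqI:
  "hardy_fun f \<Longrightarrow> hardy_fun g \<Longrightarrow> AE z in circle_measure. f z = g z \<Longrightarrow> abs_hardy f = abs_hardy g"
  by (rule Quotient3_rel_abs [OF Quotient3_hardy]) (simp add: hardy_rel_def)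

lift_definition const_hardy :: "'a::separable_complex_hilbert_space \<Rightarrow> 'a hardy" is "\<lambda>x z. x"
  by (simp add: hardy_rel_def hardy_fun_const)

lift_definition shift :: "'a::separable_complex_hilbert_space hardy \<Rightarrow> 'a hardy" is
  "\<lambda>f z. z *\<^sub>C f z"
  by (auto simp: hardy_rel_def hardy_fun_shift elim: eventually_mono)

lemma mean_respects:
  "hardy_rel f g \<Longrightarrow> (\<integral>z. f z \<partial>circle_measure) = (\<integral>z. g z \<partial>circle_measure)"
  by (auto simp: hardy_rel_def intro: integral_cong_AE hardy_fun_measurable)

text \<open>This is the Fourier coefficient of index 0; accordingly
  \<open>mean (backshift f)\<close> is the one of index 1.\<close>

lift_definition mean :: "'a::separable_complex_hilbert_space hardy \<Rightarrow> 'a" is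
  "\<lambda>f. \<integral>z. f z \<partial>circle_measure"
  by (rule mean_respects)

text \<open>The classical formula (f(z) - f(0)) / z, written on the circle.\<close>

lift_definition backshift :: "'a::separable_complex_hilbert_space hardy \<Rightarrow> 'a hardy" is
  "\<lambda>f z. cnj z *\<^sub>C (f z - (\<integral>w. f w \<partial>circle_measure))"
  subgoal for f g
    using mean_respects [of f g] hardy_fun_backshift [of f] hardy_fun_backshift [of g]
    by (auto simp: hardy_rel_def elim: eventually_mono)
  done

lemma mean_const: "mean (const_hardy x) = x"
  by transfer simp

lemma mean_shift: "mean (shift f) = 0"
proof (cases f rule: hardy_cases)
  case (1 g)
  then have "(\<integral>z. z ^ 1 *\<^sub>C g z \<partial>circle_measure) = 0"
    unfolding hardy_fun_def by blast
  with 1 show ?thesis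
    by (simp add: shift.abs_eq mean.abs_eq hardy_rel_refl hardy_fun_shift)
qed

text \<open>Almost everywhere z * cnj z = 1. Once \<open>backshift\<close> is known to be the
  adjoint S^* of the shift S, this says that I - S S^* is the projection onto the constants.\<close>

lemma shift_backshift: "shift (backshift f) + const_hardy (mean f) = f"
proof (cases f rule: hardy_cases)
  case (1 g)
  let ?c = "\<integral>w. g w \<partial>circle_measure"
  have "AE z in circle_measure. z *\<^sub>C cnj z *\<^sub>C (g z - ?c) + ?c = g z"
    using AE_circle_cmod
  proof eventually_elim
    case (elim z)
    then have "z * cnj z = 1" by (simp add: complex_norm_square [symmetric])
    then show ?case by (simp add: scaleC_scaleC scaleC_one)
  qed
  with 1 show ?thesis
    by (auto simp: shift.abs_eq backshift.abs_eq mean.abs_eq const_hardy.abs_eq plus_hardy.abs_eq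
        hardy_rel_refl hardy_fun_shift hardy_fun_backshift hardy_fun_const hardy_fun_add
        intro!: abs_hardy_eqI)
qed

lemma cinner_shift: "cinner (shift f) (shift g) = cinner f g"
proof (transfer, unfold hardy_rel_def)
  fix f g :: "complex \<Rightarrow> 'a"
  assume *: "hardy_fun f \<and> hardy_fun f \<and> (AE z in circle_measure. f z = f z)"
    "hardy_fun g \<and> hardy_fun g \<and> (AE z in circle_measure. g z = g z)"
  then have [measurable]: "f \<in> borel_measurable circle_measure" "g \<in> borel_measurable circle_measure"
    by (auto intro: hardy_fun_measurable)
  show "(\<integral>z. cinner (z *\<^sub>C f z) (z *\<^sub>C g z) \<partial>circle_measure) = (\<integral>z. cinner (f z) (g z) \<partial>circle_measure)"
  proof (rule integral_cong_AE)
    show "AE z in circle_measure. cinner (z *\<^sub>C f z) (z *\<^sub>C g z) = cinner (f z) (g z)"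
      using AE_circle_cmod
    proof eventually_elim
      case (elim z)
      then have "z * cnj z = 1" by (simp add: complex_norm_square [symmetric])
      then have "cnj z * (z * cinner (f z) (g z)) = cinner (f z) (g z)"
        by (metis mult.assoc mult.commute mult_1)
      then show ?case
        by (simp only: cinner_scaleC_left cinner_scaleC_right)
    qed
  qed measurable
qed

lemma adjoint_pair_const_mean: "adjoint_pair const_hardy mean"
proof (rule adjoint_pairI)
  fix x :: 'a and f
  show "cinner (const_hardy x) f = cinner x (mean f)"
  proof (cases f rule: hardy_cases)
    case (1 g)
    \<comment> \<open>\<open>cinner x\<close> is conjugate-linear, hence bounded and real-linear,
      and so passes through the Bochner integral.\<close>
    from integral_bounded_linear [OF bounded_bilinear.bounded_linear_right
        [OF bounded_bilinear_cinner] hardy_fun_imp_integrable [OF 1(1)]]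
    have "(\<integral>z. cinner x (g z) \<partial>circle_measure) = cinner x (\<integral>z. g z \<partial>circle_measure)" .
    with 1 show ?thesis
      by (simp add: const_hardy.abs_eq mean.abs_eq cinner_hardy.abs_eq hardy_rel_refl hardy_fun_const)
  qed
qed

lemma scaleC_left_commute: "a *\<^sub>C b *\<^sub>C x = b *\<^sub>C a *\<^sub>C x"
  by (simp add: scaleC_scaleC mult.commute)

lemma bounded_clinear_shift: "bounded_clinear shift"
proof (rule isometric_bounded_clinear)
  fix f g :: "'a hardy" and a
  show "shift (f + g) = shift f + shift g"
    by transfer (simp add: hardy_rel_def scaleC_add_right hardy_fun_add hardy_fun_shift)
  show "shift (a *\<^sub>C f) = a *\<^sub>C shift f"
    by transfer (simp add: hardy_rel_def scaleC_left_commute hardy_fun_shift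
        hardy_fun_operator [OF bounded_clinear_scaleC])
qed (rule cinner_shift)

lemma bounded_clinear_const_hardy: "bounded_clinear const_hardy"
proof (rule isometric_bounded_clinear)
  fix x y :: 'a and a
  show "const_hardy (x + y) = const_hardy x + const_hardy y"
    by transfer (simp add: hardy_rel_def hardy_fun_const)
  show "const_hardy (a *\<^sub>C x) = a *\<^sub>C const_hardy x"
    by transfer (simp add: hardy_rel_def hardy_fun_const)
  show "cinner (const_hardy x) (const_hardy x) = cinner x x"
    by (simp add: adjoint_pairD [OF adjoint_pair_const_mean] mean_const)
qed

lemma bounded_clinear_mean: "bounded_clinear mean"
  by (rule adjoint_pair_bounded_clinear [OF bounded_clinear_const_hardy adjoint_pair_const_mean])

text \<open>Split \<open>g\<close> by \<open>shift_backshift\<close>: the shifted part is handled by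
  isometry, and the constant part is orthogonal to the range of \<open>shift\<close> because
  \<open>mean (shift f) = 0\<close>.\<close>

lemma adjoint_pair_shift_backshift: "adjoint_pair shift backshift"
proof (rule adjoint_pairI)
  fix f g :: "'a hardy"
  have "cinner (shift f) g = cinner (shift f) (shift (backshift g) + const_hardy (mean g))"
    by (simp only: shift_backshift)
  also have "cinner (shift f) (const_hardy (mean g)) = cinner (mean (shift f)) (mean g)"
    by (rule adjoint_pairD [OF adjoint_pair_sym [OF adjoint_pair_const_mean], symmetric])
  then have "cinner (shift f) (shift (backshift g) + const_hardy (mean g)) = cinner f (backshift g)"
    by (simp add: cinner_add_right cinner_shift mean_shift
        bounded_bilinear.zero_left [OF bounded_bilinear_cinner])
  finally show "cinner (shift f) g = cinner f (backshift g)" .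
qed

lemma bounded_clinear_backshift: "bounded_clinear backshift"
  by (rule adjoint_pair_bounded_clinear [OF bounded_clinear_shift adjoint_pair_shift_backshift])

lemma backshift_shift: "backshift (shift f) = f"
  by (rule cinner_eqI)
    (simp add: adjoint_pairD [OF adjoint_pair_shift_backshift, symmetric] cinner_shift)

lemma backshift_const: "backshift (const_hardy x) = 0"
proof -
  have "shift (backshift (const_hardy x)) = 0"
    using shift_backshift [of "const_hardy x"] by (simp add: mean_const)
  then have "backshift (shift (backshift (const_hardy x))) = 0"
    by (simp add: bounded_clinear_0 [OF bounded_clinear_backshift])
  then show ?thesis by (simp add: backshift_shift)
qed

section \<open>Operators acting on the coefficient space\<close>

text \<open>Factoring out the shift leaves calculation rules to be proved for \<open>shift\<close>
  and \<open>id_tensor\<close> alone.\<close>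

lemma shift_tensor_eq:
  assumes "bounded_clinear A"
  shows "shift_tensor A f = shift (id_tensor A f)"
  by (cases f rule: hardy_cases)
    (simp add: assms shift_tensor_abs_hardy id_tensor_abs_hardy shift.abs_eq hardy_rel_refl
      hardy_fun_operator)

lemma id_tensor_compose:
  assumes "bounded_clinear A" "bounded_clinear B"
  shows "id_tensor A (id_tensor B f) = id_tensor (\<lambda>x. A (B x)) f"
  by (cases f rule: hardy_cases)
    (simp add: assms bounded_clinear_compose id_tensor_abs_hardy hardy_fun_operator)

lemma id_tensor_plus:
  assumes "bounded_clinear A" "bounded_clinear B"
  shows "id_tensor A f + id_tensor B f = id_tensor (\<lambda>x. A x + B x) f"
  by (cases f rule: hardy_cases)
    (simp add: assms bounded_clinear_plus id_tensor_abs_hardy hardy_fun_operator plus_hardy.abs_eq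
      hardy_rel_refl)

lemma id_tensor_ident: "id_tensor (\<lambda>x. x) f = f"
  by (simp add: id_tensor_def Quotient3_abs_rep [OF Quotient3_hardy])

lemma id_tensor_zero: "id_tensor (\<lambda>x. 0) f = 0"
  by (simp add: id_tensor_def zero_hardy_def)

lemma id_tensor_shift:
  assumes "bounded_clinear A"
  shows "id_tensor A (shift f) = shift (id_tensor A f)"
  by (cases f rule: hardy_cases)
    (simp add: assms id_tensor_abs_hardy shift.abs_eq hardy_rel_refl hardy_fun_operator
      hardy_fun_shift bounded_clinear_scale)

lemma id_tensor_const:
  assumes "bounded_clinear A"
  shows "id_tensor A (const_hardy x) = const_hardy (A x)"
  by (simp add: assms id_tensor_abs_hardy const_hardy.abs_eq hardy_fun_const)

lemma mean_id_tensor: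
  assumes "bounded_clinear A"
  shows "mean (id_tensor A f) = A (mean f)"
proof (cases f rule: hardy_cases)
  case (1 g)
  from integral_bounded_linear [OF bounded_clinear_imp_bounded_linear [OF assms]
      hardy_fun_imp_integrable [OF 1(1)]] 1
  show ?thesis
    by (simp add: assms id_tensor_abs_hardy mean.abs_eq hardy_rel_refl hardy_fun_operator)
qed

lemma adjoint_pair_id_tensor:
  assumes A: "bounded_clinear A" and adj: "adjoint_pair A A'"
  shows "adjoint_pair (id_tensor A) (id_tensor A')"
proof (rule adjoint_pairI)
  fix f g :: "'a hardy"
  have A': "bounded_clinear A'" by (rule adjoint_pair_bounded_clinear [OF A adj])
  obtain f' g' where "hardy_fun f'" "f = abs_hardy f'" "hardy_fun g'" "g = abs_hardy g'"
    by (metis hardy_cases)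
  then show "cinner (id_tensor A f) g = cinner f (id_tensor A' g)"
    by (simp add: A A' id_tensor_abs_hardy cinner_hardy.abs_eq hardy_rel_refl hardy_fun_operator
        adjoint_pairD [OF adj])
qed

text \<open>Having a formal adjoint already forces additivity; this supplies it for
  \<open>id_tensor\<close> and for both BCL operators without a bound on either.\<close>

lemma adjoint_pair_additive:
  assumes "adjoint_pair T T'"
  shows "T (x + y) = T x + T y"
  by (rule cinner_eqI)
    (simp add: adjoint_pairD [OF adjoint_pair_sym [OF assms], symmetric] cinner_add_right)

section \<open>The defect operator of a BCL pair\<close>

locale bcl =
  fixes U P :: "'a::separable_complex_hilbert_space \<Rightarrow> 'a"
  assumes triple: "bcl_triple U P"
begin

text \<open>The inverse plays the role of U^* throughout (see \<open>cadjoint_U\<close>), so words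
  in U and U^* cancel by \<open>UV\<close> and \<open>VU\<close>.\<close>

abbreviation V :: "'a \<Rightarrow> 'a" where "V \<equiv> inv U"
abbreviation Q :: "'a \<Rightarrow> 'a" where "Q \<equiv> orth_compl P"

lemma bcl_U: "bounded_clinear U"
  and bcl_P: "bounded_clinear P"
  using triple by (simp_all add: bcl_triple_def unitary_op_def orthogonal_projection_def)

lemma bcl_Q: "bounded_clinear Q"
  by (rule bounded_clinear_orth_compl [OF bcl_P])

lemma UV [simp]: "U (V x) = x"
  using triple by (simp add: bcl_triple_def unitary_op_def surj_f_inv_f)

lemma isometric_U: "cinner (U x) (U y) = cinner x y"
  using triple by (simp add: bcl_triple_def unitary_op_def)

lemma adj_U: "adjoint_pair U V"
proof (rule adjoint_pairI)
  show "cinner (U x) y = cinner x (V y)" for x y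
    using isometric_U [of x "V y"] by simp
qed

lemma bcl_V: "bounded_clinear V"
  by (rule adjoint_pair_bounded_clinear [OF bcl_U adj_U])

lemma VU [simp]: "V (U x) = x"
  by (rule cinner_eqI) (simp add: adjoint_pairD [OF adj_U, symmetric] isometric_U)

lemma cadjoint_U: "cadjoint U = V"
  by (rule cadjoint_eqI [OF adj_U])

lemma PP [simp]: "P (P x) = P x"
  using triple by (simp add: bcl_triple_def orthogonal_projection_def)

lemma adj_P: "adjoint_pair P P"
  using triple by (simp add: bcl_triple_def orthogonal_projection_def adjoint_pair_def)

lemma PQ [simp]: "P (Q x) = 0"
  and QP [simp]: "Q (P x) = 0"
  and QQ [simp]: "Q (Q x) = Q x"
  and P_plus_Q: "P x + Q x = x"
  and Q_plus_P: "Q x + P x = x"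
  by (simp_all add: orth_compl_def bounded_clinear_diff [OF bcl_P])

text \<open>Both sides equal <Q x, Q y>: after inserting P + Q = I, the cross terms vanish by P Q =
  0.\<close>

lemma adj_Q: "adjoint_pair Q Q"
proof (rule adjoint_pairI)
  fix x y
  have "cinner (Q x) y = cinner (Q x) (P y + Q y)" by (simp add: P_plus_Q)
  also have "\<dots> = cinner (P (Q x)) y + cinner (Q x) (Q y)"
    by (simp add: cinner_add_right adjoint_pairD [OF adj_P, symmetric] del: PQ)
  also have "\<dots> = cinner x (P (Q y)) + cinner (Q x) (Q y)"
    by (simp add: bounded_bilinear.zero_left [OF bounded_bilinear_cinner]
        bounded_bilinear.zero_right [OF bounded_bilinear_cinner])
  also have "\<dots> = cinner (P x + Q x) (Q y)"
    by (simp add: cinner_add_left adjoint_pairD [OF adj_P] del: PQ)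
  also have "\<dots> = cinner x (Q y)" by (simp only: P_plus_Q)
  finally show "cinner (Q x) y = cinner x (Q y)" .
qed

text \<open>The order matters, since entries are addressed by position: entries 5 to 9 here are
  matched with entries 1 to 5 of \<open>adj_ops\<close>.\<close>

lemmas bcl_ops = bcl_U bcl_V bcl_P bcl_Q
  bounded_clinear_compose [OF bcl_P bcl_V] bounded_clinear_compose [OF bcl_Q bcl_V]
  bounded_clinear_compose [OF bcl_U bcl_P] bounded_clinear_compose [OF bcl_U bcl_Q]
  bounded_clinear_compose [OF bcl_U bounded_clinear_compose [OF bcl_P bcl_V]]
  bounded_clinear_compose [OF bcl_U bounded_clinear_compose [OF bcl_Q bcl_V]]

lemmas adj_ops =
  adjoint_pair_compose [OF adj_P adjoint_pair_sym [OF adj_U]]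
  adjoint_pair_compose [OF adj_Q adjoint_pair_sym [OF adj_U]]
  adjoint_pair_compose [OF adj_U adj_P]
  adjoint_pair_compose [OF adj_U adj_Q]
  adjoint_pair_compose [OF adj_U adjoint_pair_compose [OF adj_P adjoint_pair_sym [OF adj_U]]]

lemmas bcl_zero = bcl_U [THEN bounded_clinear_0] bcl_V [THEN bounded_clinear_0]
  bcl_P [THEN bounded_clinear_0] bcl_Q [THEN bounded_clinear_0]
lemmas bcl_add = bcl_U [THEN bounded_clinear_add] bcl_V [THEN bounded_clinear_add]
  bcl_P [THEN bounded_clinear_add] bcl_Q [THEN bounded_clinear_add]
lemmas bcl_diff = bcl_U [THEN bounded_clinear_diff] bcl_V [THEN bounded_clinear_diff]
  bcl_P [THEN bounded_clinear_diff] bcl_Q [THEN bounded_clinear_diff]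

section \<open>Explicit adjoints, commutation and the block form of the defect\<close>

definition fst_adj :: "'a hardy \<Rightarrow> 'a hardy" where
  "fst_adj f = id_tensor (\<lambda>x. U (P x)) f + id_tensor (\<lambda>x. U (Q x)) (backshift f)"

definition snd_adj :: "'a hardy \<Rightarrow> 'a hardy" where
  "snd_adj f = id_tensor (\<lambda>x. Q (V x)) f + id_tensor (\<lambda>x. P (V x)) (backshift f)"

lemma bcl_fst_eq:
  "bcl_fst U P f = id_tensor (\<lambda>x. P (V x)) f + shift (id_tensor (\<lambda>x. Q (V x)) f)"
  by (simp add: bcl_fst_def cadjoint_U o_def shift_tensor_eq bcl_ops)

lemma bcl_snd_eq:
  "bcl_snd U P f = id_tensor (\<lambda>x. U (Q x)) f + shift (id_tensor (\<lambda>x. U (P x)) f)"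
  by (simp add: bcl_snd_def o_def shift_tensor_eq bcl_ops)

text \<open>Termwise: each coefficient operator is replaced by its adjoint, and \<open>shift\<close>
  by \<open>backshift\<close> with the order of composition reversed.\<close>

lemma adj_fst: "adjoint_pair (bcl_fst U P) fst_adj"
  unfolding bcl_fst_eq [abs_def] fst_adj_def [abs_def]
  by (intro adjoint_pair_plus adjoint_pair_compose [OF adjoint_pair_shift_backshift]
      adjoint_pair_id_tensor adj_ops bcl_ops)

lemma adj_snd: "adjoint_pair (bcl_snd U P) snd_adj"
  unfolding bcl_snd_eq [abs_def] snd_adj_def [abs_def]
  by (intro adjoint_pair_plus adjoint_pair_compose [OF adjoint_pair_shift_backshift]
      adjoint_pair_id_tensor adj_ops bcl_ops)

lemmas fst_add = adjoint_pair_additive [OF adj_fst]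
lemmas snd_add = adjoint_pair_additive [OF adj_snd]

lemmas id_tensor_add =
  adjoint_pair_id_tensor [OF bcl_ops(5) adj_ops(1), THEN adjoint_pair_additive]
  adjoint_pair_id_tensor [OF bcl_ops(6) adj_ops(2), THEN adjoint_pair_additive]
  adjoint_pair_id_tensor [OF bcl_ops(7) adj_ops(3), THEN adjoint_pair_additive]
  adjoint_pair_id_tensor [OF bcl_ops(8) adj_ops(4), THEN adjoint_pair_additive]
  adjoint_pair_id_tensor [OF bcl_ops(9) adj_ops(5), THEN adjoint_pair_additive]

text \<open>In either order the coefficients of 1 and z^2 vanish by P Q = Q P = 0, while those of z
  add up to I; both products are \<open>shift\<close>.\<close>

lemma bcl_commute: "bcl_fst U P (bcl_snd U P f) = bcl_snd U P (bcl_fst U P f)"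
proof -
  have "id_tensor P f + id_tensor Q f = f"
    by (simp add: id_tensor_plus bcl_ops P_plus_Q id_tensor_ident)
  moreover have "id_tensor (\<lambda>x. U (Q (V x))) f + id_tensor (\<lambda>x. U (P (V x))) f = f"
    by (simp add: id_tensor_plus bcl_ops bcl_U [THEN bounded_clinear_add, symmetric] Q_plus_P id_tensor_ident)
  ultimately show ?thesis
    by (simp add: bcl_fst_eq bcl_snd_eq id_tensor_add id_tensor_compose id_tensor_shift bcl_ops
        bcl_zero id_tensor_zero bounded_clinear_0 [OF bounded_clinear_shift]
        bounded_clinear_add [OF bounded_clinear_shift, symmetric])
qed

lemma fst_const: "bcl_fst U P (const_hardy x) = const_hardy (P (V x)) + shift (const_hardy (Q (V x)))"
  by (simp add: bcl_fst_eq id_tensor_const bcl_ops)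

lemma snd_const: "bcl_snd U P (const_hardy x) = const_hardy (U (Q x)) + shift (const_hardy (U (P x)))"
  by (simp add: bcl_snd_eq id_tensor_const bcl_ops)

text \<open>The mixed terms vanish by Q P = P Q = 0, leaving U Q U^* on \<open>f\<close> and U P U^*
  on its non-constant part. Only the U P U^* part of the mean is missing.\<close>

lemma snd_snd_adj: "bcl_snd U P (snd_adj f) + const_hardy (U (P (V (mean f)))) = f"
proof -
  have "shift (id_tensor (\<lambda>x. U (P (V x))) (backshift f)) + const_hardy (U (P (V (mean f)))) =
      id_tensor (\<lambda>x. U (P (V x))) (shift (backshift f) + const_hardy (mean f))"
    by (simp add: id_tensor_add id_tensor_shift id_tensor_const bcl_ops)
  also have "\<dots> = id_tensor (\<lambda>x. U (P (V x))) f" by (simp only: shift_backshift)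
  finally have "shift (id_tensor (\<lambda>x. U (P (V x))) (backshift f)) + const_hardy (U (P (V (mean f)))) =
    id_tensor (\<lambda>x. U (P (V x))) f" .
  moreover have "id_tensor (\<lambda>x. U (Q (V x))) f + id_tensor (\<lambda>x. U (P (V x))) f = f"
    by (simp add: id_tensor_plus bcl_ops bcl_U [THEN bounded_clinear_add, symmetric] Q_plus_P id_tensor_ident)
  ultimately show ?thesis
    by (simp add: bcl_snd_eq snd_adj_def id_tensor_add id_tensor_compose bcl_ops
        bcl_zero id_tensor_zero bounded_clinear_0 [OF bounded_clinear_shift] add.assoc)
qed

lemma mean_fst_adj: "mean (fst_adj f) = U (P (mean f)) + U (Q (mean (backshift f)))"
  by (simp add: fst_adj_def bounded_clinear_add [OF bounded_clinear_mean] mean_id_tensor bcl_ops)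

lemma mean_snd_adj: "mean (snd_adj f) = Q (V (mean f)) + P (V (mean (backshift f)))"
  by (simp add: snd_adj_def bounded_clinear_add [OF bounded_clinear_mean] mean_id_tensor bcl_ops)

text \<open>\<open>y\<close> is the mean of \<open>snd_adj f\<close>, and expanding V2 on the
  constant U P U^* y gives the terms in \<open>y\<close>. In V1 W V1^* the relations U^* U = I and P
  Q = 0 leave only the constant \<open>P (mean f)\<close>.\<close>

lemma pair_defect_eq:
  fixes f :: "'a hardy"
  defines "y \<equiv> Q (V (mean f)) + P (V (mean (backshift f)))"
  shows "pair_defect (bcl_fst U P) (bcl_snd U P) f =
    const_hardy (U (Q (U (P (V y)))) - P (mean f)) + shift (const_hardy (U (P (U (P (V y))))))"
proof -
  \<comment> \<open>The defect applies the two adjoints in the order opposite to the one that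
    telescopes; they commute because the operators do and adjoints are unique.\<close>
  have comm: "fst_adj (snd_adj f) = snd_adj (fst_adj f)"
    using adjoint_pair_unique [OF adjoint_pair_compose [OF adj_snd adj_fst],
        unfolded bcl_commute [symmetric], OF adjoint_pair_compose [OF adj_fst adj_snd]]
    by (rule fun_cong)
  \<comment> \<open>Facts 1 and 2 insert the decomposition \<open>snd_snd_adj\<close> of
    \<open>snd_adj f\<close> and of \<open>fst_adj f\<close>, so that each difference in the defect
    collapses to a single term.\<close>
  have 1: "bcl_snd U P (snd_adj f) = bcl_snd U P (bcl_snd U P (snd_adj (snd_adj f))) +
      bcl_snd U P (const_hardy (U (P (V (mean (snd_adj f))))))"
    by (simp only: snd_add [symmetric] snd_snd_adj)
  have 2: "bcl_fst U P (fst_adj f) = bcl_fst U P (bcl_snd U P (snd_adj (fst_adj f))) +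
      bcl_fst U P (const_hardy (U (P (V (mean (fst_adj f))))))"
    by (simp only: fst_add [symmetric] snd_snd_adj)
  have "pair_defect (bcl_fst U P) (bcl_snd U P) f =
      bcl_snd U P (const_hardy (U (P (V (mean (snd_adj f)))))) -
      bcl_fst U P (const_hardy (U (P (V (mean (fst_adj f))))))"
    unfolding pair_defect_def cadjoint_eqI [OF adj_fst] cadjoint_eqI [OF adj_snd] comm
    using 1 2 by simp
  also have "\<dots> = const_hardy (U (Q (U (P (V y))))) + shift (const_hardy (U (P (U (P (V y)))))) -
      const_hardy (P (mean f))"
    by (simp add: snd_const fst_const mean_fst_adj mean_snd_adj bcl_add bcl_zero y_def
        bounded_clinear_0 [OF bounded_clinear_shift] bounded_clinear_0 [OF bounded_clinear_const_hardy])
  finally show ?thesis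
    by (simp add: bounded_clinear_diff [OF bounded_clinear_const_hardy])
qed

section \<open>Compactness of the blocks\<close>

lemma adj_PUP: "adjoint_pair (\<lambda>x. P (U (P x))) (\<lambda>x. P (V (P x)))"
  by (rule adjoint_pair_compose [OF adj_P adj_ops(3)])

lemma bcl_PUP: "bounded_clinear (\<lambda>x. P (U (P x)))"
  by (rule bounded_clinear_compose [OF bcl_P bcl_ops(7)])

lemma compact_PVP: "compact_op (\<lambda>x. P (U (P x))) \<Longrightarrow> compact_op (\<lambda>x. P (V (P x)))"
  by (rule compact_op_adjoint [OF _ adj_PUP])

text \<open>Expanding both factors Q = I - P in U Q U P U^* Q U^* gives four terms; these are the
  three other than U U P U^* U^*, with opposite sign.\<close>

definition remainder :: "'a \<Rightarrow> 'a" where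
  "remainder x = U (U (P (V (P (V x))))) + U (P (U (P (V (V x))))) - U (P (U (P (V (P (V x))))))"

text \<open>
  The first two terms on the right are \<open>(U\<^sup>2 P - P U\<^sup>2) U\<^sup>*\<^sup>2\<close>, and every term of the remainder has a factor
  \<open>P U P\<close> or \<open>P U\<^sup>* P\<close>.
\<close>

lemma constant_block_eq:
  "U (Q (U (P (V (Q (V x)))))) - P x = U (U (P (V (V x)))) - P x - remainder x"
  by (simp add: remainder_def orth_compl_def bcl_diff)

lemma compact_remainder:
  assumes "compact_op (\<lambda>x. P (U (P x)))"
  shows "compact_op remainder"
proof -
  note T = assms and T' = compact_PVP [OF assms]
  have VV: "bounded_clinear (\<lambda>x. V (V x))" and UU: "bounded_clinear (\<lambda>x. U (U x))"
    by (rule bounded_clinear_compose [OF bcl_V bcl_V] bounded_clinear_compose [OF bcl_U bcl_U])+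
  have 1: "compact_op (\<lambda>x. U (U (P (V (P (V x))))))"
    by (rule compact_op_compose_left [OF UU compact_op_compose_right [OF bcl_V T']])
  have 2: "compact_op (\<lambda>x. U (P (U (P (V (V x))))))"
    by (rule compact_op_compose_left [OF bcl_U compact_op_compose_right [OF VV T]])
  have 3: "compact_op (\<lambda>x. U (P (U (P (V (P (V x)))))))"
    by (rule compact_op_compose_left [OF bcl_ops(7) compact_op_compose_left
          [OF bcl_U compact_op_compose_right [OF bcl_V T']]])
  show ?thesis
    unfolding remainder_def [abs_def] by (rule compact_op_minus [OF compact_op_plus [OF 1 2] 3])
qed

lemma compact_pair_defect_iff:
  "compact_op (pair_defect (bcl_fst U P) (bcl_snd U P)) \<longleftrightarrow>
    compact_op (\<lambda>x. P (U (P x))) \<and> compact_op (\<lambda>x. U (U (P x)) - P (U (U x)))"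
    (is "compact_op ?H \<longleftrightarrow> compact_op ?T \<and> compact_op ?C")
proof -
  \<comment> \<open>\<open>J1\<close> embeds the coefficient space as the coefficient of index 1,
    and \<open>E1\<close> reads that coefficient off; \<open>const_hardy\<close> and
    \<open>mean\<close> do the same for index 0.\<close>
  note J1 = bounded_clinear_compose [OF bounded_clinear_shift bounded_clinear_const_hardy]
  note E1 = bounded_clinear_compose [OF bounded_clinear_mean bounded_clinear_backshift]
  show ?thesis
  proof (intro iffI conjI)
    assume H: "compact_op ?H"
    \<comment> \<open>The lower right block, conjugated by U so that it becomes T T^* with T = P U
      P.\<close>
    have "compact_op (\<lambda>x. V (mean (backshift (?H (shift (const_hardy (U x)))))))"
      by (rule compact_op_compose_left [OF bcl_V compact_op_compose_left [OF E1
            compact_op_compose_right [OF bounded_clinear_compose [OF J1 bcl_U] H]]])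
    also have "(\<lambda>x. V (mean (backshift (?H (shift (const_hardy (U x))))))) = (\<lambda>x. P (U (P (V (P x)))))"
      by (simp add: pair_defect_eq mean_shift mean_const backshift_shift backshift_const bcl_zero
          bounded_clinear_add [OF bounded_clinear_backshift])
    finally have "compact_op (\<lambda>x. ?T (P (V (P x))))" by simp
    \<comment> \<open>T T^* has the form A^* A for A = T^*, so T^* is compact first, and then
      T.\<close>
    then have "compact_op (\<lambda>x. P (V (P x)))"
      by (rule compact_op_of_adjoint_compose [OF adjoint_pair_bounded_clinear [OF bcl_PUP adj_PUP]
            adjoint_pair_sym [OF adj_PUP]])
    then show T: "compact_op ?T"
      by (rule compact_op_adjoint [OF _ adjoint_pair_sym [OF adj_PUP]])
    \<comment> \<open>The compression to the constants is the upper left block.\<close>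
    have "compact_op (\<lambda>x. mean (?H (const_hardy x)))"
      by (rule compact_op_compose_left [OF bounded_clinear_mean
            compact_op_compose_right [OF bounded_clinear_const_hardy H]])
    also have "(\<lambda>x. mean (?H (const_hardy x))) = (\<lambda>x. U (Q (U (P (V (Q (V x)))))) - P x)"
      by (simp add: pair_defect_eq mean_shift mean_const backshift_const bcl_zero
          bounded_clinear_add [OF bounded_clinear_mean] bounded_clinear_0 [OF bounded_clinear_mean])
    finally have "compact_op (\<lambda>x. U (Q (U (P (V (Q (V x)))))) - P x)" .
    from compact_op_plus [OF this compact_remainder [OF T]]
    have "compact_op (\<lambda>x. U (U (P (V (V x)))) - P x)"
      by (simp add: constant_block_eq)
    \<comment> \<open>Composing with U^2 on the right cancels the two trailing factors
      \<open>V\<close> and turns P into P U^2.\<close>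
    from compact_op_compose_right [OF bounded_clinear_compose [OF bcl_U bcl_U] this]
    show "compact_op ?C" by simp
  next
    assume "compact_op ?T \<and> compact_op ?C"
    then have T: "compact_op ?T" and C: "compact_op ?C" by auto
    have "compact_op (\<lambda>x. U (U (P (V (V x)))) - P x)"
      using compact_op_compose_right [OF bounded_clinear_compose [OF bcl_V bcl_V] C] by simp
    from compact_op_minus [OF this compact_remainder [OF T]]
    have 1: "compact_op (\<lambda>x. U (Q (U (P (V (Q (V x)))))) - P x)"
      by (simp add: constant_block_eq)
    have UQU: "bounded_clinear (\<lambda>x. U (Q (U x)))"
      by (rule bounded_clinear_compose [OF bcl_ops(8) bcl_U])
    \<comment> \<open>Each of the remaining blocks contains a factor P U^* P or P U P; the
      hypothesis on U^2 P - P U^2 is spent entirely on block 1.\<close>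
    have 2: "compact_op (\<lambda>x. U (Q (U (P (V (P (V x)))))))"
      by (rule compact_op_compose_left [OF UQU compact_op_compose_right [OF bcl_V compact_PVP [OF T]]])
    have 3: "compact_op (\<lambda>x. U (P (U (P (V (Q (V x)))))))"
      by (rule compact_op_compose_left [OF bcl_U compact_op_compose_right
            [OF bounded_clinear_compose [OF bcl_V bcl_ops(6)] T]])
    have 4: "compact_op (\<lambda>x. U (P (U (P (V (P (V x)))))))"
      by (rule compact_op_compose_left [OF bcl_U compact_op_compose_right
            [OF bounded_clinear_compose [OF bcl_V bcl_ops(5)] T]])
    \<comment> \<open>Splitting \<open>y\<close> into its two summands displays the defect as a sum
      of four blocks, each preceded by a coefficient map and followed by an embedding.\<close>
    have H: "?H = (\<lambda>f. (const_hardy (U (Q (U (P (V (Q (V (mean f))))))) - P (mean f)) +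
          const_hardy (U (Q (U (P (V (P (V (mean (backshift f)))))))))) +
        (shift (const_hardy (U (P (U (P (V (Q (V (mean f))))))))) +
          shift (const_hardy (U (P (U (P (V (P (V (mean (backshift f))))))))))))"
      by (rule ext) (simp add: pair_defect_eq bcl_add bounded_clinear_add [OF bounded_clinear_shift]
          bounded_clinear_add [OF bounded_clinear_const_hardy]
          bounded_clinear_diff [OF bounded_clinear_const_hardy])
    show "compact_op ?H" unfolding H
      by (rule compact_op_plus [OF compact_op_plus [OF
          compact_op_compose_left [OF bounded_clinear_const_hardy compact_op_compose_right [OF bounded_clinear_mean 1]]
          compact_op_compose_left [OF bounded_clinear_const_hardy compact_op_compose_right [OF E1 2]]]
          compact_op_plus [OF
          compact_op_compose_left [OF J1 compact_op_compose_right [OF bounded_clinear_mean 3]]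
          compact_op_compose_left [OF J1 compact_op_compose_right [OF E1 4]]]])
  qed
qed

end

theorem theorem3p11:
  fixes U P :: "'a::separable_complex_hilbert_space \<Rightarrow> 'a"
  assumes "bcl_triple U P"
  shows "compact_op (pair_defect (bcl_fst U P) (bcl_snd U P)) \<longleftrightarrow>
    compact_op (P \<circ> U \<circ> P) \<and> compact_op (\<lambda>x. U (U (P x)) - P (U (U x)))"
  using bcl.compact_pair_defect_iff [OF bcl.intro [OF assms]] by (simp add: o_def)

end
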